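(* Let $N$ be a positive integer, $k$ a nonnegative integer, $n\ge 2$ an integer, and $x$ a real or complex variable. Then $$\Psi_k^N(x,n)=\frac{k!\,N!}{(k+N)!}\sum_{j=0}^{k}\binom{k+N}{j}M_j^N(n)\,S(k+N-j,N)\,x^{k+N-j},$$ where $S(\ell,m)$ denotes the Stirling numbers of the second kind.
   Context: Let $\mu$ be the Möbius function. For a positive integer $n$ and a real or complex variable $x$, the Möbius–Bernoulli power sums $\Psi_k(x,n)$, $k=0,1,2,\dots$, are defined by the generating function $$\sum_{d\mid n}\mu(d)\frac{e^{\left(1+\frac{x}{d}\right)td}-e^{td}}{e^{td}-1}=\sum_{k=0}^{\infty}\Psi_k(x,n)\frac{t^k}{k!},$$ and their sums of products are $$\Psi_k^N(x,n):=\sum_{k_1+\cdots+k_N=k}\binom{k}{k_1,\dots,k_N}\Psi_{k_1}(x,n)\cdots\Psi_{k_N}(x,n),$$ the sum being over ordered $N$-tuples of nonnegative integers, with $\binom{k}{k_1,\dots,k_N}=\frac{k!}{k_1!\cdots k_N!}$; equivalently $\left(\sum_{d\mid n}\mu(d)\frac{e^{(1+x/d)td}-e^{td}}{e^{td}-1}\right)^N=\sum_{k\ge0}\Psi_k^N(x,n)\frac{t^k}{k!}$. The Möbius–Bernoulli numbers $M_k(n)$ are defined by $$\sum_{d\mid n}\frac{t\,\mu(d)}{e^{td}-1}=\sum_{k=0}^{\infty}M_k(n)\frac{t^k}{k!},\qquad |t|<\frac{2\pi}{n},$$ and the higher order Möbius–Bernoulli numbers by $$M_k^N(n):=\sum_{k_1+\cdots+k_N=k}\binom{k}{k_1,\dots,k_N}M_{k_1}(n)\cdots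 M_{k_N}(n)$$ (sum over ordered $N$-tuples of nonnegative integers); equivalently $\left(\sum_{d\mid n}\frac{t\mu(d)}{e^{td}-1}\right)^N=\sum_{k\ge0}M_k^N(n)\frac{t^k}{k!}$ for $|t|<2\pi/n$. In all generating functions the left side is extended by continuity to $t=0$. *)

theory Defs
  imports "HOL-Complex_Analysis.Complex_Analysis" "HOL-Computational_Algebra.Squarefree"
    "HOL-Combinatorics.Stirling"
begin

definition moebius :: "nat \<Rightarrow> int" where
  "moebius n = (if squarefree n then (-1) ^ card (prime_factors n) else 0)"

text \<open>
  The point \<open>t = 0\<close> is excluded because the generating functions below have a removable
  singularity there, at which division by zero would give a spurious value. A function with
  such an expansion has the limit \<open>a 0\<close> at \<open>0\<close>, so the expansion is that of the continuous
  extension. The coefficients are unique by \<open>egf_coeff_eqI\<close>; they exist for the two functions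
  of interest by \<open>sums_moebius_bernoulli\<close> and \<open>sums_moebius_bernoulli_psi\<close>.
\<close>

definition has_egf :: "(complex \<Rightarrow> complex) \<Rightarrow> (nat \<Rightarrow> complex) \<Rightarrow> bool" where
  "has_egf f a \<longleftrightarrow>
     (\<exists>r>0. \<forall>t. t \<noteq> 0 \<and> norm t < r \<longrightarrow> (\<lambda>k. a k * (t ^ k / fact k)) sums f t)"

definition egf_coeff :: "(complex \<Rightarrow> complex) \<Rightarrow> nat \<Rightarrow> complex" where
  "egf_coeff f = (THE a. has_egf f a)"

definition moebius_bernoulli_gf :: "nat \<Rightarrow> complex \<Rightarrow> complex" where
  "moebius_bernoulli_gf n t =
     (\<Sum>d | d dvd n. t * of_int (moebius d) / (exp (t * of_nat d) - 1))"

definition moebius_bernoulli_psi_gf :: "complex \<Rightarrow> nat \<Rightarrow> complex \<Rightarrow> complex" where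
  "moebius_bernoulli_psi_gf x n t =
     (\<Sum>d | d dvd n. of_int (moebius d) *
        ((exp ((1 + x / of_nat d) * t * of_nat d) - exp (t * of_nat d)) /
         (exp (t * of_nat d) - 1)))"

definition moebius_bernoulli :: "nat \<Rightarrow> nat \<Rightarrow> complex" where
  "moebius_bernoulli k n = egf_coeff (moebius_bernoulli_gf n) k"

definition moebius_bernoulli_psi :: "nat \<Rightarrow> complex \<Rightarrow> nat \<Rightarrow> complex" where
  "moebius_bernoulli_psi k x n = egf_coeff (moebius_bernoulli_psi_gf x n) k"

text \<open>
  \<open>natpermute k N\<close> is the set of lists of \<open>N\<close> natural numbers with sum \<open>k\<close>.
\<close>

definition sum_of_products :: "nat \<Rightarrow> nat \<Rightarrow> (nat \<Rightarrow> complex) \<Rightarrow> complex" where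
  "sum_of_products N k a =
     (\<Sum>ks\<in>natpermute k N. fact k / (\<Prod>i<N. fact (ks ! i)) * (\<Prod>i<N. a (ks ! i)))"

definition moebius_bernoulli_higher :: "nat \<Rightarrow> nat \<Rightarrow> nat \<Rightarrow> complex" where
  "moebius_bernoulli_higher N k n = sum_of_products N k (\<lambda>j. moebius_bernoulli j n)"

definition moebius_bernoulli_psi_higher :: "nat \<Rightarrow> nat \<Rightarrow> complex \<Rightarrow> nat \<Rightarrow> complex" where
  "moebius_bernoulli_psi_higher N k x n =
     sum_of_products N k (\<lambda>j. moebius_bernoulli_psi j x n)"

lemma has_egf_unique:
  assumes "has_egf f a" "has_egf f b"
  shows   "a = b"
proof
  fix m
  obtain r where r: "r > 0"
    "\<And>t. t \<noteq> 0 \<Longrightarrow> norm t < r \<Longrightarrow> (\<lambda>k. a k * (t ^ k / fact k)) sums f t"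
    using assms(1) unfolding has_egf_def by blast
  obtain s where s: "s > 0"
    "\<And>t. t \<noteq> 0 \<Longrightarrow> norm t < s \<Longrightarrow> (\<lambda>k. b k * (t ^ k / fact k)) sums f t"
    using assms(2) unfolding has_egf_def by blast
  define c where "c k = (a k - b k) / fact k" for k
  define u where "u = min r s"
  have u: "u > 0" using r s by (simp add: u_def)
  have *: "(\<lambda>k. c k * t ^ k) sums 0" if "t \<noteq> 0" "norm t < u" for t
    using sums_diff[OF r(2)[of t] s(2)[of t]] that
    by (simp add: u_def c_def diff_divide_distrib left_diff_distrib)
  have "((\<lambda>_. 0) \<longlongrightarrow> c 0) (at (0::complex))"
    by (rule powser_limit_0_strong[OF u]) (use * in auto)
  hence c0: "c 0 = 0"
    using tendsto_unique[OF trivial_limit_at tendsto_const] by metis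
  have "c m = 0"
  proof (rule ccontr)
    assume m: "c m \<noteq> 0"
    hence "m > 0" using c0 by (cases m) auto
    have **: "(\<lambda>k. c k * (t - 0) ^ k) sums (\<lambda>_. 0) t" if "norm (t - 0) < u" for t
      using *[of t] that c0 by (cases "t = 0") simp_all
    show False
    proof (rule powser_0_nonzero[OF u ** refl m \<open>m > 0\<close>])
      fix v :: real
      assume v: "0 < v" "\<And>z::complex. z \<in> cball 0 v - {0} \<Longrightarrow> (0::complex) \<noteq> 0"
      show False using v(1) v(2)[of "of_real v"] by simp
    qed
  qed
  thus "a m = b m" by (simp add: c_def)
qed

lemma egf_coeff_eqI:
  assumes "has_egf f a"
  shows   "egf_coeff f = a"
  unfolding egf_coeff_def using assms has_egf_unique by blast

lemma sums_egf_coeff: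
  assumes r: "r > 0" and hol: "f holomorphic_on ball 0 r - {0}" and lim: "f \<midarrow>0\<rightarrow> c"
    and t: "t \<noteq> 0" "norm t < r"
  shows "(\<lambda>k. egf_coeff f k * (t ^ k / fact k)) sums f t"
proof -
  define g where "g = (\<lambda>y. if y = 0 then c else f y)"
  define a where "a k = (deriv ^^ k) g 0" for k
  have "g holomorphic_on ball 0 r"
    unfolding g_def by (rule removable_singularity) (use hol lim in auto)
  hence *: "(\<lambda>k. a k * (t ^ k / fact k)) sums f t" if "t \<noteq> 0" "norm t < r" for t
    using holomorphic_power_series[of g 0 r t] that by (simp add: a_def g_def)
  hence "has_egf f a"
    unfolding has_egf_def using r by blast
  thus ?thesis
    using * t by (simp add: egf_coeff_eqI)
qed

lemma exp_mult_dvd_neq_1: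
  assumes "n > 0" "d dvd n" "t \<noteq> 0" "norm t < 2 * pi / real n"
  shows   "exp (t * of_nat d) \<noteq> (1 :: complex)"
proof
  assume "exp (t * of_nat d) = 1"
  then obtain m :: int where m: "Re (t * of_nat d) = 0" "Im (t * of_nat d) = of_int (2 * m) * pi"
    by (auto simp: exp_eq_1)
  have d: "d > 0" "d \<le> n" using assms by (auto simp: dvd_imp_le intro: Nat.gr0I)
  have "norm (t * of_nat d) \<le> norm t * real n"
    using d by (simp add: norm_mult mult_left_mono)
  also have "\<dots> < 2 * pi"
    using assms by (simp add: field_simps)
  finally have "\<bar>Im (t * of_nat d)\<bar> < 2 * pi"
    using abs_Im_le_cmod[of "t * of_nat d"] by linarith
  hence "\<bar>real_of_int m\<bar> < 1"
    unfolding m by (simp add: abs_mult)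
  hence "m = 0" by linarith
  hence "t * of_nat d = 0" using m by (simp add: complex_eq_iff)
  thus False using assms d by simp
qed

lemma tendsto_divide_exp_minus_1:
  assumes "d > 0"
  shows   "((\<lambda>t::complex. t / (exp (t * of_nat d) - 1)) \<longlongrightarrow> 1 / of_nat d) (at 0)"
proof -
  have "((\<lambda>t::complex. exp (t * of_nat d)) has_field_derivative of_nat d) (at 0)"
    by (auto intro!: derivative_eq_intros)
  hence "((\<lambda>t::complex. (exp (t * of_nat d) - 1) / t) \<longlongrightarrow> of_nat d) (at 0)"
    by (simp add: has_field_derivative_iff)
  hence "((\<lambda>t::complex. inverse ((exp (t * of_nat d) - 1) / t)) \<longlongrightarrow> inverse (of_nat d)) (at 0)"
    by (rule tendsto_inverse) (use assms in auto)
  thus ?thesis by (simp add: inverse_eq_divide)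
qed

lemma sums_moebius_bernoulli:
  assumes "n > 0" "t \<noteq> 0" "norm t < 2 * pi / real n"
  shows   "(\<lambda>k. moebius_bernoulli k n * (t ^ k / fact k)) sums moebius_bernoulli_gf n t"
proof -
  have hol: "moebius_bernoulli_gf n holomorphic_on ball 0 (2 * pi / real n) - {0}"
    unfolding moebius_bernoulli_gf_def
    by (intro holomorphic_intros) (use assms exp_mult_dvd_neq_1[of n] in auto)
  have "((\<lambda>t. \<Sum>d | d dvd n. of_int (moebius d) * (t / (exp (t * of_nat d) - 1)))
          \<longlongrightarrow> (\<Sum>d | d dvd n. of_int (moebius d) * (1 / of_nat d))) (at (0::complex))"
    by (intro tendsto_intros tendsto_divide_exp_minus_1) (use assms in \<open>auto intro: Nat.gr0I\<close>)
  hence lim: "moebius_bernoulli_gf n \<midarrow>0\<rightarrow> (\<Sum>d | d dvd n. of_int (moebius d) * (1 / of_nat d))"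
    by (simp add: moebius_bernoulli_gf_def[abs_def] mult_ac)
  show ?thesis
    unfolding moebius_bernoulli_def
    by (rule sums_egf_coeff[OF _ hol lim]) (use assms in auto)
qed

lemma sums_moebius_bernoulli_psi:
  assumes "n > 0" "t \<noteq> 0" "norm t < 2 * pi / real n"
  shows   "(\<lambda>k. moebius_bernoulli_psi k x n * (t ^ k / fact k)) sums
             moebius_bernoulli_psi_gf x n t"
proof -
  define h where "h t = (exp (x * t) - 1) / t" for t
  have hol: "moebius_bernoulli_psi_gf x n holomorphic_on ball 0 (2 * pi / real n) - {0}"
    unfolding moebius_bernoulli_psi_gf_def
    by (intro holomorphic_intros) (use assms exp_mult_dvd_neq_1[of n] in auto)
  have "((\<lambda>t. exp (x * t)) has_field_derivative x) (at 0)"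
    by (auto intro!: derivative_eq_intros)
  hence h: "(h \<longlongrightarrow> x) (at 0)"
    by (simp add: has_field_derivative_iff h_def[abs_def])
  define c where "c = (\<Sum>d | d dvd n. of_int (moebius d) * (exp (0 * of_nat d) * x * (1 / of_nat d)))"
  have "((\<lambda>t. \<Sum>d | d dvd n. of_int (moebius d) *
                (exp (t * of_nat d) * h t * (t / (exp (t * of_nat d) - 1)))) \<longlongrightarrow> c) (at 0)"
    unfolding c_def
    by (intro tendsto_intros tendsto_divide_exp_minus_1 h) (use assms in \<open>auto intro: Nat.gr0I\<close>)
  also have "?this \<longleftrightarrow> moebius_bernoulli_psi_gf x n \<midarrow>0\<rightarrow> c"
  proof (rule filterlim_cong[OF refl refl])
    show "\<forall>\<^sub>F t in at 0. (\<Sum>d | d dvd n. of_int (moebius d) *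
            (exp (t * of_nat d) * h t * (t / (exp (t * of_nat d) - 1)))) =
            moebius_bernoulli_psi_gf x n t"
      using eventually_neq_at_within[of 0 0]
    proof eventually_elim
      case (elim t)
      have "exp (t * of_nat d) * h t * (t / (exp (t * of_nat d) - 1)) =
              (exp ((1 + x / of_nat d) * t * of_nat d) - exp (t * of_nat d)) /
              (exp (t * of_nat d) - 1)" if "d dvd n" for d
      proof -
        have "d \<noteq> 0" using that assms by auto
        hence "(1 + x / of_nat d) * t * of_nat d = t * of_nat d + x * t"
          by (simp add: field_simps)
        hence "exp ((1 + x / of_nat d) * t * of_nat d) = exp (t * of_nat d) * exp (x * t)"
          by (simp only: exp_add)
        thus ?thesis using elim by (simp add: h_def right_diff_distrib)
      qed
      thus ?case
        unfolding moebius_bernoulli_psi_gf_def by (intro sum.cong refl) (simp only: mem_Collect_eq)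
    qed
  qed
  finally have lim: "moebius_bernoulli_psi_gf x n \<midarrow>0\<rightarrow> c" .
  show ?thesis
    unfolding moebius_bernoulli_psi_def
    by (rule sums_egf_coeff[OF _ hol lim]) (use assms in auto)
qed

end

theory Submission
  imports Defs
begin

text \<open>
  Since \<open>e\<^bsup>td\<^esup> / (e\<^bsup>td\<^esup> - 1) = 1 + 1 / (e\<^bsup>td\<^esup> - 1)\<close> and \<open>\<mu>\<close> sums to zero over the divisors of
  \<open>n \<ge> 2\<close>, the generating function of the power sums is \<open>(e\<^bsup>xt\<^esup> - 1) / t\<close> times that of the
  Moebius--Bernoulli numbers. Take \<open>N\<close>-th powers and compare coefficients of \<open>t\<^bsup>k+N\<^esup>\<close>, using
  \<open>(e\<^bsup>xt\<^esup> - 1)\<^bsup>N\<^esup> = N! \<Sum>\<^sub>l S(l, N) (xt)\<^bsup>l\<^esup> / l!\<close>.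
\<close>

text \<open>A new prime factor flips the sign if \<open>d\<close> is squarefree; otherwise both
  values vanish, since every factor of a squarefree number is squarefree.\<close>

lemma moebius_prime_mult:
  assumes p: "prime p" and np: "\<not> p dvd d"
  shows "moebius (p * d) = - moebius d"
proof (cases "squarefree d")
  case True
  have "coprime p d" using p np by (simp add: prime_imp_coprime)
  hence "squarefree (p * d)" using True p by (simp add: squarefree_mult_coprime squarefree_prime)
  moreover have "d \<noteq> 0" using np by (metis dvd_0_right)
  hence "prime_factors (p * d) = insert p (prime_factors d)"
    using p by (auto simp: prime_factors_product prime_prime_factors)
  moreover have "p \<notin> prime_factors d" using np by auto
  ultimately show ?thesis using True by (simp add: moebius_def)
next
  case False
  thus ?thesis using squarefree_multD(2)[of p d] by (auto simp: moebius_def)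
qed

lemma moebius_eq_0_if_square_dvd:
  assumes "p ^ 2 dvd d" "\<not> p dvd 1"
  shows "moebius d = 0"
  using not_squarefreeI[OF assms] by (simp add: moebius_def)

text \<open>Fix a prime \<open>p\<close> dividing \<open>n\<close>. Each divisor \<open>d\<close>
  not divisible by \<open>p\<close> cancels against \<open>p * d\<close>, and the remaining divisors
  are multiples of \<open>p ^ 2\<close>.\<close>

lemma sum_moebius_divisors:
  assumes "n \<ge> 2"
  shows "(\<Sum>d | d dvd n. moebius d) = 0"
proof -
  obtain p where p: "prime p" "p dvd n"
    using prime_factor_nat[of n] assms by auto
  define A where "A = {d. d dvd n \<and> \<not> p dvd d}"
  have p1: "\<not> p dvd 1" using p by auto
  have fin: "finite {d. d dvd n}" using assms by simp
  have finA: "finite A" unfolding A_def by (rule finite_subset[OF _ fin]) auto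
  have inj: "inj_on ((*) p) A" using p by (auto simp: inj_on_def)
  have sub: "A \<union> (*) p ` A \<subseteq> {d. d dvd n}"
    using p by (auto simp: A_def intro!: divides_mult prime_imp_coprime)
  have "moebius d = 0" if d: "d dvd n" "d \<notin> A \<union> (*) p ` A" for d
  proof (rule moebius_eq_0_if_square_dvd[OF _ p1])
    obtain c where c: "d = p * c" using d by (auto simp: A_def)
    hence "c dvd n" using d by (auto dest: dvd_mult_right)
    \<comment> \<open>Otherwise \<open>c\<close> would lie in \<open>A\<close> and
      \<open>d = p * c\<close> in its image.\<close>
    hence "p dvd c" using d c by (auto simp: A_def)
    thus "p ^ 2 dvd d" by (simp add: c power2_eq_square)
  qed
  hence "(\<Sum>d | d dvd n. moebius d) = (\<Sum>d\<in>A \<union> (*) p ` A. moebius d)"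
    by (intro sum.mono_neutral_right fin sub) auto
  also have "\<dots> = (\<Sum>d\<in>A. moebius d) + (\<Sum>d\<in>(*) p ` A. moebius d)"
    by (rule sum.union_disjoint) (use finA in \<open>auto simp: A_def\<close>)
  also have "(\<Sum>d\<in>(*) p ` A. moebius d) = (\<Sum>d\<in>A. moebius (p * d))"
    by (simp add: sum.reindex[OF inj])
  also have "\<dots> = (\<Sum>d\<in>A. - moebius d)"
    by (intro sum.cong refl moebius_prime_mult p) (auto simp: A_def)
  finally show ?thesis by (simp add: sum_negf)
qed

text \<open>The series f = e^(xt) - 1 satisfies f' = x (f + 1). Differentiating a power of f
  therefore reproduces the Stirling recurrence on coefficients. The recurrence involves two
  exponents, so \<open>N\<close> is arbitrary in the induction.\<close>

lemma fps_exp_minus_1_power_nth: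
  fixes x :: "'a :: field_char_0"
  shows "(fps_exp x - 1) ^ N $ l = fact N * of_nat (Stirling l N) * x ^ l / fact l"
proof (induction l arbitrary: N)
  case 0
  show ?case by (cases N) simp_all
next
  case (Suc l)
  show ?case
  proof (cases N)
    case 0
    thus ?thesis by simp
  next
    case (Suc M)
    define f where "f = fps_exp x - 1"
    have "fps_deriv (f ^ Suc M) = fps_const (of_nat (Suc M) * x) * (f ^ Suc M + f ^ M)"
    proof -
      have "fps_deriv (f ^ Suc M) = fps_const (of_nat (Suc M)) * (fps_const x * fps_exp x) * f ^ M"
        unfolding fps_deriv_power by (simp add: f_def)
      also have "fps_exp x = f + 1" by (simp add: f_def)
      finally show ?thesis
        by (simp add: ring_distribs mult_ac del: of_nat_Suc flip: fps_const_mult)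
    qed
    from arg_cong[OF this, of "\<lambda>g. g $ l"]
    have "of_nat (Suc l) * (f ^ Suc M $ Suc l) = of_nat (Suc M) * x * (f ^ Suc M $ l + f ^ M $ l)"
      by (simp del: of_nat_Suc power_Suc)
    \<comment> \<open>This is S(l+1, M+1) = (M+1) S(l, M+1) + S(l, M), multiplied by (M+1)! x^(l+1)
      / l!.\<close>
    also have "\<dots> = fact (Suc M) * of_nat (Stirling (Suc l) (Suc M)) * x ^ Suc l / fact l"
      unfolding f_def Suc.IH by (simp add: field_simps)
    finally have "f ^ Suc M $ Suc l =
        fact (Suc M) * of_nat (Stirling (Suc l) (Suc M)) * x ^ Suc l / fact l / of_nat (Suc l)"
      by (simp add: nonzero_eq_divide_eq mult_ac del: of_nat_Suc power_Suc Stirling.simps fact_Suc)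
    thus ?thesis
      unfolding Suc f_def by (simp add: mult.commute del: of_nat_Suc power_Suc Stirling.simps)
  qed
qed

text \<open>Dividing coefficients by factorials absorbs the multinomial coefficient, so the theorem
  becomes a statement about powers of formal power series.\<close>

lemma sum_of_products_eq_fps_power_nth:
  "sum_of_products N k a = fact k * (Abs_fps (\<lambda>j. a j / fact j) ^ N $ k)"
proof (cases N)
  case 0
  thus ?thesis by (auto simp: sum_of_products_def natpermute_0)
next
  case (Suc M)
  thus ?thesis
    by (simp add: sum_of_products_def fps_power_nth_Suc prod_dividef sum_distrib_left
        lessThan_Suc_atMost atMost_atLeast0 del: power_Suc)
qed

text \<open>Inside the smaller of the two discs both series converge absolutely, so their Cauchy
  product converges to the product.\<close>

lemma has_egf_mult:
  assumes "has_egf f (\<lambda>k. fact k * F $ k)" "has_egf g (\<lambda>k. fact k * G $ k)"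
  shows "has_egf (\<lambda>t. f t * g t) (\<lambda>k. fact k * (F * G) $ k)"
proof -
  obtain r s where rs: "r > 0" "s > 0"
    and f: "\<And>t. t \<noteq> 0 \<Longrightarrow> norm t < r \<Longrightarrow> (\<lambda>k. F $ k * t ^ k) sums f t"
    and g: "\<And>t. t \<noteq> 0 \<Longrightarrow> norm t < s \<Longrightarrow> (\<lambda>k. G $ k * t ^ k) sums g t"
    using assms unfolding has_egf_def by auto
  have "(\<lambda>k. (F * G) $ k * t ^ k) sums (f t * g t)" if t: "t \<noteq> 0" "norm t < min r s" for t
  proof -
    \<comment> \<open>Convergence at a point \<open>z\<close> of larger norm than \<open>t\<close>
      yields absolute convergence at \<open>t\<close>; \<open>z\<close> must be nonzero because
      \<open>has_egf\<close> says nothing at 0.\<close>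
    obtain u where u: "norm t < u" "u < min r s" using dense t(2) by blast
    define z :: complex where "z = of_real u"
    have "u > 0" using u(1) norm_ge_zero[of t] by linarith
    hence z: "z \<noteq> 0" "norm z = u" by (simp_all add: z_def)
    have "summable (\<lambda>k. norm (F $ k * t ^ k))"
      by (rule powser_insidea[OF sums_summable[OF f[of z]]]) (use u z in auto)
    moreover have "summable (\<lambda>k. norm (G $ k * t ^ k))"
      by (rule powser_insidea[OF sums_summable[OF g[of z]]]) (use u z in auto)
    ultimately have "(\<lambda>k. \<Sum>i\<le>k. (F $ i * t ^ i) * (G $ (k - i) * t ^ (k - i))) sums
        ((\<Sum>k. F $ k * t ^ k) * (\<Sum>k. G $ k * t ^ k))"
      by (rule Cauchy_product_sums)
    moreover have "(\<Sum>i\<le>k. (F $ i * t ^ i) * (G $ (k - i) * t ^ (k - i))) = (F * G) $ k * t ^ k" for k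
      unfolding fps_mult_nth sum_distrib_right atMost_atLeast0
    proof (intro sum.cong refl)
      fix i assume "i \<in> {0..k}"
      hence "t ^ k = t ^ i * t ^ (k - i)" by (simp flip: power_add)
      thus "F $ i * t ^ i * (G $ (k - i) * t ^ (k - i)) = F $ i * G $ (k - i) * t ^ k" by simp
    qed
    ultimately show ?thesis
      using f[of t] g[of t] t by (simp add: sums_iff)
  qed
  thus ?thesis
    unfolding has_egf_def using rs by (intro exI[of _ "min r s"]) simp
qed

lemma has_egf_exp_minus_1_divide:
  "has_egf (\<lambda>t. (exp (x * t) - 1) / t) (\<lambda>k. fact k * fps_shift 1 (fps_exp x - 1) $ k)"
proof -
  have "(\<lambda>k. x ^ Suc k / fact (Suc k) * t ^ k) sums ((exp (x * t) - 1) / t)" if "t \<noteq> 0" for t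
  proof -
    have "(\<lambda>k. (x * t) ^ Suc k /\<^sub>R fact (Suc k)) sums (exp (x * t) - 1)"
      \<comment> \<open>Subtracting 1 removes the constant term of the exponential series.\<close>
      using exp_converges[of "x * t"] by (subst sums_Suc_iff) simp
    from sums_divide[OF this, of t]
    have "(\<lambda>k. (x * t) ^ Suc k /\<^sub>R fact (Suc k) / t) sums ((exp (x * t) - 1) / t)" .
    moreover have "(x * t) ^ Suc k /\<^sub>R fact (Suc k) / t = x ^ Suc k / fact (Suc k) * t ^ k" for k
      using that
      by (simp add: scaleR_conv_of_real power_mult_distrib field_simps del: fact_Suc of_nat_Suc)
    ultimately show ?thesis by simp
  qed
  thus ?thesis
    unfolding has_egf_def
    by (intro exI[of _ 1]) (simp add: mult.assoc del: fact_Suc of_nat_Suc power_Suc)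
qed

text \<open>The bound on \<open>t\<close> keeps all denominators nonzero. Splitting each summand
  leaves an extra e^(xt) - 1 times the sum of \<open>moebius\<close> over the divisors, which is
  zero.\<close>

lemma moebius_bernoulli_psi_gf_eq:
  assumes "n \<ge> 2" "t \<noteq> 0" "norm t < 2 * pi / real n"
  shows "moebius_bernoulli_psi_gf x n t = (exp (x * t) - 1) / t * moebius_bernoulli_gf n t"
proof -
  have "of_int (moebius d) * ((exp ((1 + x / of_nat d) * t * of_nat d) - exp (t * of_nat d)) /
          (exp (t * of_nat d) - 1)) =
        (exp (x * t) - 1) * of_int (moebius d) +
        (exp (x * t) - 1) / t * (t * of_int (moebius d) / (exp (t * of_nat d) - 1))"
    if d: "d dvd n" for d
  proof -
    have neq: "exp (t * of_nat d) - 1 \<noteq> 0"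
      using exp_mult_dvd_neq_1[of n d t] d assms by simp
    have "d \<noteq> 0" using d assms by (metis dvd_0_left not_numeral_le_zero)
    hence "(1 + x / of_nat d) * t * of_nat d = t * of_nat d + x * t"
      by (simp add: field_simps)
    hence "exp ((1 + x / of_nat d) * t * of_nat d) = exp (t * of_nat d) * exp (x * t)"
      by (simp only: exp_add)
    thus ?thesis using neq \<open>t \<noteq> 0\<close> by (simp add: divide_simps) (simp add: algebra_simps)
  qed
  hence "moebius_bernoulli_psi_gf x n t =
      (exp (x * t) - 1) * of_int (\<Sum>d | d dvd n. moebius d) +
      (exp (x * t) - 1) / t * moebius_bernoulli_gf n t"
    unfolding moebius_bernoulli_psi_gf_def moebius_bernoulli_gf_def
    by (simp add: sum.distrib sum_distrib_left)
  thus ?thesis using sum_moebius_divisors assms(1) by simp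
qed

text \<open>Uniqueness of expansions turns the pointwise identity into a formal one; from here on
  convergence is no longer an issue.\<close>

lemma fps_moebius_bernoulli_psi:
  assumes "n \<ge> 2"
  shows "fps_X * Abs_fps (\<lambda>k. moebius_bernoulli_psi k x n / fact k) =
           (fps_exp x - 1) * Abs_fps (\<lambda>k. moebius_bernoulli k n / fact k)"
    (is "fps_X * ?P = ?E * ?M")
proof -
  have r: "2 * pi / real n > 0" using assms by simp
  have "has_egf (moebius_bernoulli_gf n) (\<lambda>k. fact k * ?M $ k)"
    unfolding has_egf_def using r sums_moebius_bernoulli[of n] assms
    by (intro exI[of _ "2 * pi / real n"]) auto
  from has_egf_mult[OF has_egf_exp_minus_1_divide this]
  have "has_egf (\<lambda>t. (exp (x * t) - 1) / t * moebius_bernoulli_gf n t)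
          (\<lambda>k. fact k * (fps_shift 1 ?E * ?M) $ k)" .
  moreover have "has_egf (\<lambda>t. (exp (x * t) - 1) / t * moebius_bernoulli_gf n t)
          (\<lambda>k. moebius_bernoulli_psi k x n)"
    unfolding has_egf_def
    using r sums_moebius_bernoulli_psi[of n _ x] assms moebius_bernoulli_psi_gf_eq[of n _ x]
    by (intro exI[of _ "2 * pi / real n"]) auto
  ultimately have eq: "(\<lambda>k. fact k * (fps_shift 1 ?E * ?M) $ k) = (\<lambda>k. moebius_bernoulli_psi k x n)"
    by (rule has_egf_unique)
  have "?P = fps_shift 1 ?E * ?M"
    by (rule fps_ext) (simp flip: fun_cong[OF eq])
  \<comment> \<open>The shift loses nothing, as the constant term of \<open>?E\<close> is
    zero.\<close>
  moreover have "fps_X * fps_shift 1 ?E = ?E"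
    by (rule fps_ext) (simp add: fps_X_mult_nth)
  ultimately show ?thesis by (metis mult.assoc)
qed

theorem theorem3p1:
  fixes N k n :: nat and x :: complex
  assumes "N \<ge> 1" and "n \<ge> 2"
  shows "moebius_bernoulli_psi_higher N k x n =
           fact k * fact N / fact (k + N) *
           (\<Sum>j=0..k. of_nat ((k + N) choose j) * moebius_bernoulli_higher N j n *
                      of_nat (Stirling (k + N - j) N) * x ^ (k + N - j))"
proof -
  define P where "P = Abs_fps (\<lambda>k. moebius_bernoulli_psi k x n / fact k)"
  define M where "M = Abs_fps (\<lambda>k. moebius_bernoulli k n / fact k)"
  \<comment> \<open>Clearing the N-fold division by t moves the coefficient from index
    \<open>k\<close> to \<open>k + N\<close>.\<close>
  have "P ^ N $ k = (fps_X * P) ^ N $ (k + N)"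
    by (simp add: power_mult_distrib fps_X_power_mult_nth)
  also have "\<dots> = (M ^ N * (fps_exp x - 1) ^ N) $ (k + N)"
    using fps_moebius_bernoulli_psi[OF assms(2), of x]
    by (simp add: P_def M_def power_mult_distrib mult.commute)
  also have "\<dots> = (\<Sum>j=0..k + N. M ^ N $ j *
      (fact N * of_nat (Stirling (k + N - j) N) * x ^ (k + N - j) / fact (k + N - j)))"
    by (simp add: fps_mult_nth fps_exp_minus_1_power_nth)
  \<comment> \<open>For \<open>j\<close> > \<open>k\<close> the first Stirling argument
    \<open>k + N - j\<close> is below \<open>N\<close>, so the term vanishes.\<close>
  also have "\<dots> = (\<Sum>j=0..k. M ^ N $ j *
      (fact N * of_nat (Stirling (k + N - j) N) * x ^ (k + N - j) / fact (k + N - j)))"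
    by (rule sum.mono_neutral_right) auto
  \<comment> \<open>Here 1 / (k+N-j)! is rewritten as C(k+N, j) j! / (k+N)!, and the factor j! turns
    the series coefficient into the higher order number.\<close>
  also have "\<dots> = (\<Sum>j=0..k. fact N / fact (k + N) * (of_nat ((k + N) choose j) *
      (fact j * M ^ N $ j) * of_nat (Stirling (k + N - j) N) * x ^ (k + N - j)))"
    by (intro sum.cong refl) (simp add: binomial_fact field_simps)
  finally have "P ^ N $ k = fact N / fact (k + N) *
      (\<Sum>j=0..k. of_nat ((k + N) choose j) * (fact j * M ^ N $ j) *
        of_nat (Stirling (k + N - j) N) * x ^ (k + N - j))"
    by (simp only: sum_distrib_left)
  thus ?thesis
    by (simp add: moebius_bernoulli_psi_higher_def moebius_bernoulli_higher_def
        sum_of_products_eq_fps_power_nth P_def M_def)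
qed

end
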